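(* The set of pairs $(U_1,U_2)\in\Omega$ for which the metric $ds^2=(U_1(q_1)-U_2(q_2))(dq_1^2+dq_2^2)$ on the torus $\mathbb R^2/\mathbb Z^2$ is nondegenerate is of first Baire category in $\Omega$, where $\Omega$ carries the topology induced by the Whitney $C^\infty$-topology of $C^\infty(\mathbb R/\mathbb Z)\times C^\infty(\mathbb R/\mathbb Z)$.
   Context: **The set $\Omega$.** $\Omega$ is the set of pairs $(U_1,U_2)$ such that for $i=1,2$: $U_i\in C^\infty(\mathbb R)$ is real valued; $U_i(q+1)=U_i(q)$ for all $q$; $U_i$ has exactly one minimum and one maximum in $[0,1)$, both nondegenerate, and $U_i''\ne0$ at every critical point of $U_i$ (so these two points are the only critical points in $[0,1)$); and $U_1(q_1)>U_2(q_2)$ for all $q_1,q_2\in\mathbb R$. On the compact manifold $\mathbb R/\mathbb Z$ the Whitney $C^\infty$-topology is the topology of uniform convergence of all derivatives. **Notation.** For $(U_1,U_2)\in\Omega$ let $c_1=\max U_1=U_1(M_1)$, $c_2=\min U_1=U_1(m_1)$, $c_3=\max U_2=U_2(M_2)$, $c_4=\min U_2=U_2(m_2)$, so $c_4<c_3<c_2<c_1$. For $c\in[c_4,c_1]$ let $$F_1(c)=\int_{\{q\in[0,1]:U_1(q)\ge c\}}(U_1(q)-c)^{1/2}dq,\qquad F_2(c)=\int_{\{q\in[0,1]:U_2(q)\le c\}}(c-U_2(q))^{1/2}dq .$$ It is known that $F_1$ is continuous and strictly decreasing, $C^\infty$ on $[c_4,c_2)\cup(c_2,c_1]$; $F_2$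 is continuous and strictly increasing, $C^\infty$ on $[c_4,c_3)\cup(c_3,c_1]$; their derivatives do not vanish (one-sided derivatives at $c_1,c_4$). The curvature of the plane curve $\gamma=(F_1(c),F_2(c))$ is $$\kappa(c)=\frac{F_2''F_1'-F_1''F_2'}{((F_1')^2+(F_2')^2)^{3/2}}(c),\qquad c\neq c_2,c_3.$$ **Typical numbers.** A real number $\alpha$ is typical if there exist $\tau>0$ and $\delta(\alpha)>0$ such that $|k_1+\alpha k_2|\ge\frac{\delta(\alpha)}{|k_2|\log(1+|k_2|)^\tau}$ for all $k_1,k_2\in\mathbb Z$ with $k_2\ne0$. **Nondegenerate metrics.** The metric $ds^2=(U_1(q_1)-U_2(q_2))(dq_1^2+dq_2^2)$ on $\mathbb R^2/\mathbb Z^2$ is nondegenerate if $(U_1,U_2)\in\Omega$ and: 1. $\kappa$ has finitely many zeros on $[c_4,c_3)\cup(c_2,c_1]$, each of first order; 2. if $\kappa(\tilde c)=0$, then $F_2'(\tilde c)/F_1'(\tilde c)$ is typical; 3. $F_2'(c_i)/F_1'(c_i)$ is typical for $i=1,4$; 4. $F_2(c_i)/F_1(c_i)$ is typical for $i=2,3$. *)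

theory Defs
  imports "HOL-Analysis.Analysis"
begin

section \<open>The space of smooth functions on the circle\<close>

text \<open>Functions on the circle are represented by 1-periodic functions on the line.\<close>

definition smooth_circle :: "(real \<Rightarrow> real) set" where
  "smooth_circle = {U. (\<forall>k q. (deriv ^^ k) U field_differentiable at q) \<and> (\<forall>q. U (q + 1) = U q)}"

text \<open>The topology of uniform convergence of all derivatives. By periodicity and continuity, the
  pointwise strict bound below is equivalent to a strict bound on the supremum.\<close>

definition Cinf_ball :: "(real \<Rightarrow> real) \<Rightarrow> nat \<Rightarrow> real \<Rightarrow> (real \<Rightarrow> real) set" where
  "Cinf_ball U k e =
     {V \<in> smooth_circle. \<forall>q. \<bar>(deriv ^^ k) V q - (deriv ^^ k) U q\<bar> < e}"

definition Cinf_topology :: "(real \<Rightarrow> real) topology" where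
  "Cinf_topology =
     topology_generated_by {Cinf_ball U k e | U k e. U \<in> smooth_circle \<and> 0 < e}"

section \<open>The set of admissible pairs\<close>

definition local_min_at :: "(real \<Rightarrow> real) \<Rightarrow> real \<Rightarrow> bool" where
  "local_min_at U q \<longleftrightarrow> (\<forall>\<^sub>F x in at q. U q \<le> U x)"

definition local_max_at :: "(real \<Rightarrow> real) \<Rightarrow> real \<Rightarrow> bool" where
  "local_max_at U q \<longleftrightarrow> (\<forall>\<^sub>F x in at q. U x \<le> U q)"

text \<open>Minima and maxima are local ones. As every critical point is nondegenerate, it is a local
  extremum, so the minimum and the maximum are the only critical points in a period.\<close>

definition simple_Morse :: "(real \<Rightarrow> real) \<Rightarrow> bool" where
  "simple_Morse U \<longleftrightarrow>
     (\<exists>!q. q \<in> {0..<1} \<and> local_min_at U q) \<and>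
     (\<exists>!q. q \<in> {0..<1} \<and> local_max_at U q) \<and>
     (\<forall>q. deriv U q = 0 \<longrightarrow> deriv (deriv U) q \<noteq> 0)"

definition Omega :: "((real \<Rightarrow> real) \<times> (real \<Rightarrow> real)) set" where
  "Omega = {(U1, U2). U1 \<in> smooth_circle \<and> U2 \<in> smooth_circle \<and>
     simple_Morse U1 \<and> simple_Morse U2 \<and> (\<forall>q1 q2. U1 q1 > U2 q2)}"

definition Omega_topology :: "((real \<Rightarrow> real) \<times> (real \<Rightarrow> real)) topology" where
  "Omega_topology = subtopology (prod_topology Cinf_topology Cinf_topology) Omega"

section \<open>Baire category\<close>

definition nowhere_dense_in :: "'a topology \<Rightarrow> 'a set \<Rightarrow> bool" where
  "nowhere_dense_in X A \<longleftrightarrow> A \<subseteq> topspace X \<and> X interior_of (X closure_of A) = {}"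

definition first_category_in :: "'a topology \<Rightarrow> 'a set \<Rightarrow> bool" where
  "first_category_in X S \<longleftrightarrow>
     (\<exists>A :: nat \<Rightarrow> 'a set. (\<forall>n. nowhere_dense_in X (A n)) \<and> S = (\<Union>n. A n))"

section \<open>Nondegenerate metrics\<close>

definition typical :: "real \<Rightarrow> bool" where
  "typical \<alpha> \<longleftrightarrow> (\<exists>\<tau>>0. \<exists>\<delta>>0. \<forall>k1 k2 :: int. k2 \<noteq> 0 \<longrightarrow>
     \<bar>of_int k1 + \<alpha> * of_int k2\<bar> \<ge>
       \<delta> / (\<bar>of_int k2\<bar> * (ln (1 + \<bar>of_int k2\<bar>)) powr \<tau>))"

definition max_val :: "(real \<Rightarrow> real) \<Rightarrow> real" where
  "max_val U = (SUP q. U q)"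

definition min_val :: "(real \<Rightarrow> real) \<Rightarrow> real" where
  "min_val U = (INF q. U q)"

definition F1 :: "(real \<Rightarrow> real) \<Rightarrow> real \<Rightarrow> real" where
  "F1 U1 c = integral {q \<in> {0..1}. U1 q \<ge> c} (\<lambda>q. sqrt (U1 q - c))"

definition F2 :: "(real \<Rightarrow> real) \<Rightarrow> real \<Rightarrow> real" where
  "F2 U2 c = integral {q \<in> {0..1}. U2 q \<le> c} (\<lambda>q. sqrt (c - U2 q))"

text \<open>Differentiating relative to the closed interval gives the one-sided derivatives at its
  endpoints and the ordinary derivatives inside.\<close>

definition deriv_on :: "real set \<Rightarrow> (real \<Rightarrow> real) \<Rightarrow> real \<Rightarrow> real" where
  "deriv_on I f c = vector_derivative f (at c within I)"

definition kappa :: "(real \<Rightarrow> real) \<Rightarrow> (real \<Rightarrow> real) \<Rightarrow> real \<Rightarrow> real" where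
  "kappa U1 U2 c =
    (let D = deriv_on {min_val U2..max_val U1};
         f1 = F1 U1; f2 = F2 U2
     in (D (D f2) c * D f1 c - D (D f1) c * D f2 c) /
          ((D f1 c)\<^sup>2 + (D f2 c)\<^sup>2) powr (3/2))"

text \<open>Nondegeneracy of the metric \<open>(U1 q1 - U2 q2) (dq1\<^sup>2 + dq2\<^sup>2)\<close> is a condition on the
  pair \<open>(U1, U2)\<close>. The zeros in the second condition range over the whole domain of \<open>kappa\<close>,
  the interval without the two inner critical values \<open>c2\<close> and \<open>c3\<close>.\<close>

definition nondegenerate_metric :: "(real \<Rightarrow> real) \<Rightarrow> (real \<Rightarrow> real) \<Rightarrow> bool" where
  "nondegenerate_metric U1 U2 \<longleftrightarrow>
    (let c1 = max_val U1; c2 = min_val U1; c3 = max_val U2; c4 = min_val U2;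
         D = deriv_on {c4..c1}; \<kappa> = kappa U1 U2;
         Z = {c \<in> {c4..<c3} \<union> {c2<..c1}. \<kappa> c = 0}
     in (U1, U2) \<in> Omega \<and>
        finite Z \<and>
        (\<forall>c\<in>Z. \<exists>d. d \<noteq> 0 \<and> (\<kappa> has_real_derivative d) (at c within {c4..c1})) \<and>
        (\<forall>c \<in> {c4..c1} - {c2, c3}. \<kappa> c = 0 \<longrightarrow> typical (D (F2 U2) c / D (F1 U1) c)) \<and>
        (\<forall>c \<in> {c1, c4}. typical (D (F2 U2) c / D (F1 U1) c)) \<and>
        (\<forall>c \<in> {c2, c3}. typical (F2 U2 c / F1 U1 c)))"

end

theory Submission
  imports Defs "HOL-Library.Periodic_Fun"
begin

text \<open>Already the condition at \<open>c2 = min U1\<close> fails generically. Both integration sets are there the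
  whole period, so \<open>F2 c2 / F1 c2\<close> is the quotient of \<open>\<integral> sqrt (c2 - U2)\<close> by \<open>\<integral> sqrt (U1 - c2)\<close>,
  which depends continuously on the pair even for uniform convergence. Typical numbers lie in a
  countable union of closed sets free of rationals. The preimages of these sets are closed; they
  have empty interior because replacing \<open>U2\<close> by \<open>U2 - t\<close> increases the quotient strictly and
  continuously in \<open>t\<close>, so that it becomes rational for arbitrarily small \<open>t\<close>.\<close>

section \<open>Diophantine numbers\<close>

text \<open>A power replaces the logarithmic factor and \<open>1 / (real n + 1)\<close> replaces the
  constant, so that one natural number indexes the family. The lower bound is weaker than that of
  \<open>typical\<close>, hence the sets are larger, but it stays positive, which is enough to
  exclude rationals.\<close>

definition diophantine_level :: "nat \<Rightarrow> real set" where
  "diophantine_level n = {\<alpha>. \<forall>k1 k2 :: int. k2 \<noteq> 0 \<longrightarrow>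
     1 / (real n + 1) / (\<bar>of_int k2\<bar> * (1 + \<bar>of_int k2\<bar>) ^ n) \<le> \<bar>of_int k1 + \<alpha> * of_int k2\<bar>}"

lemma closed_diophantine_level: "closed (diophantine_level n)"
proof -
  have "diophantine_level n = (\<Inter>k1::int. \<Inter>k2\<in>{k2::int. k2 \<noteq> 0}.
     {\<alpha>. 1 / (real n + 1) / (\<bar>of_int k2\<bar> * (1 + \<bar>of_int k2\<bar>) ^ n) \<le> \<bar>of_int k1 + \<alpha> * of_int k2\<bar>})"
    by (auto simp: diophantine_level_def)
  also have "closed \<dots>"
    by (intro closed_INT ballI closed_Collect_le continuous_intros)
  finally show ?thesis .
qed

text \<open>For \<open>x = p / q\<close> the choice \<open>k1 = - p\<close>, \<open>k2 = q\<close>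
  makes the linear form vanish, whereas the required lower bound is positive.\<close>

lemma rational_notin_diophantine_level:
  assumes "x \<in> \<rat>"
  shows "x \<notin> diophantine_level n"
proof
  assume x: "x \<in> diophantine_level n"
  obtain p q :: int where q: "q > 0" and xpq: "x = of_int p / of_int q"
    using assms by (rule Rats_cases')
  define b where "b = 1 / (real n + 1) / (\<bar>real_of_int q\<bar> * (1 + \<bar>real_of_int q\<bar>) ^ n)"
  have "q \<noteq> 0" using q by simp
  then have "b \<le> \<bar>real_of_int (- p) + x * real_of_int q\<bar>"
    unfolding b_def by (rule x[unfolded diophantine_level_def mem_Collect_eq, rule_format])
  moreover have "real_of_int (- p) + x * real_of_int q = 0"
    using q xpq by simp
  moreover have "0 < b"
    unfolding b_def using q by (intro divide_pos_pos mult_pos_pos zero_less_power) auto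
  ultimately show False by simp
qed

lemma typical_imp_diophantine_level:
  assumes "typical \<alpha>"
  shows "\<exists>n. \<alpha> \<in> diophantine_level n"
proof -
  obtain \<tau> \<delta> where \<tau>: "\<tau> > 0" and \<delta>: "\<delta> > 0" and bd: "\<And>k1 k2 :: int. k2 \<noteq> 0 \<Longrightarrow>
     \<bar>of_int k1 + \<alpha> * of_int k2\<bar> \<ge> \<delta> / (\<bar>of_int k2\<bar> * (ln (1 + \<bar>of_int k2\<bar>)) powr \<tau>)"
    using assms unfolding typical_def by blast
  \<comment> \<open>The same \<open>n\<close> does two jobs: as an exponent it dominates
    \<open>\<tau>\<close>, and through \<open>1 / (real n + 1)\<close> it falls below
    \<open>\<delta>\<close>.\<close>
  obtain n where n: "real n \<ge> max \<tau> (1 / \<delta>)"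
    using real_arch_simple by blast
  have "1 \<le> \<delta> * real n"
    using n \<delta> by (simp add: field_simps)
  then have \<delta>n: "1 / (real n + 1) \<le> \<delta>"
    using \<delta> by (simp add: field_simps)
  have "1 / (real n + 1) / (\<bar>of_int k2\<bar> * (1 + \<bar>of_int k2\<bar>) ^ n) \<le> \<bar>of_int k1 + \<alpha> * of_int k2\<bar>"
    if k2: "k2 \<noteq> 0" for k1 k2 :: int
  proof -
    define k where "k = \<bar>real_of_int k2\<bar>"
    have k: "k \<ge> 1" using k2 by (simp add: k_def)
    \<comment> \<open>The denominator \<open>k * ln (1 + k) powr \<tau>\<close> must be positive for
      the comparison of fractions below.\<close>
    have ln_pos: "ln (1 + k) > 0" using k by simp
    have "ln (1 + k) powr \<tau> \<le> (1 + k) powr \<tau>"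
    proof (rule powr_mono2)
      show "ln (1 + k) \<le> 1 + k" using k ln_add_one_self_le_self[of k] by linarith
    qed (use \<tau> ln_pos in linarith)+
    also have "\<dots> \<le> (1 + k) powr real n"
      using k n by (intro powr_mono; linarith)
    also have "\<dots> = (1 + k) ^ n"
      using k by (simp add: powr_realpow)
    finally have "ln (1 + k) powr \<tau> \<le> (1 + k) ^ n" .
    then have "1 / (real n + 1) / (k * (1 + k) ^ n) \<le> \<delta> / (k * ln (1 + k) powr \<tau>)"
      using k \<delta> \<delta>n ln_pos
      by (intro frac_le mult_left_mono mult_pos_pos; simp)
    also have "\<dots> \<le> \<bar>of_int k1 + \<alpha> * of_int k2\<bar>"
      using bd[OF k2, of k1] by (simp add: k_def)
    finally show ?thesis by (simp add: k_def)
  qed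
  then have "\<alpha> \<in> diophantine_level n"
    by (simp only: diophantine_level_def mem_Collect_eq) simp
  then show ?thesis ..
qed

section \<open>Functions on the circle\<close>

lemma smooth_circle_continuous:
  assumes "U \<in> smooth_circle"
  shows "continuous_on S U"
proof -
  have "(deriv ^^ 0) U field_differentiable at q" for q
    using assms unfolding smooth_circle_def by blast
  then have "U field_differentiable at q" for q by simp
  then show ?thesis
    by (meson continuous_at_imp_continuous_on field_differentiable_imp_continuous_at)
qed

text \<open>Compactness of the unit interval gives a maximum there, and periodicity moves any point
  to its fractional part.\<close>

lemma periodic_continuous_attains_sup:
  fixes f :: "real \<Rightarrow> real"
  assumes "\<And>q. f (q + 1) = f q" and "continuous_on UNIV f"
  shows "\<exists>p. \<forall>q. f q \<le> f p"
proof -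
  interpret periodic_fun_simple' f by standard (rule assms(1))
  have "\<exists>p\<in>{0..1}. \<forall>q\<in>{0..1}. f q \<le> f p"
    using continuous_on_subset[OF assms(2)] by (intro continuous_attains_sup) auto
  then obtain p where p: "\<And>q. q \<in> {0..1} \<Longrightarrow> f q \<le> f p"
    by blast
  have "f q = f (frac q)" for q
    using minus_of_int[of q "\<lfloor>q\<rfloor>"] by (simp add: frac_def)
  moreover have "frac q \<in> {0..1}" for q :: real
    using frac_lt_1[of q] by simp
  ultimately show ?thesis using p by metis
qed

lemma periodic_continuous_attains_inf:
  fixes f :: "real \<Rightarrow> real"
  assumes "\<And>q. f (q + 1) = f q" and "continuous_on UNIV f"
  shows "\<exists>p. \<forall>q. f p \<le> f q"
proof -
  have "\<exists>p. \<forall>q. - f q \<le> - f p"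
    using assms by (intro periodic_continuous_attains_sup continuous_on_minus) simp_all
  then show ?thesis by simp
qed

lemma smooth_circle_periodic: "U \<in> smooth_circle \<Longrightarrow> U (q + 1) = U q"
  by (simp add: smooth_circle_def)

lemma bdd_below_smooth_circle:
  assumes "U \<in> smooth_circle"
  shows "bdd_below (range U)"
proof -
  obtain p where "\<And>q. U p \<le> U q"
    using periodic_continuous_attains_inf[of U] smooth_circle_periodic[OF assms]
      smooth_circle_continuous[OF assms] by blast
  then show ?thesis by (intro bdd_belowI2)
qed

lemma min_val_le: "U \<in> smooth_circle \<Longrightarrow> min_val U \<le> U q"
  unfolding min_val_def by (rule cINF_lower) (auto simp: bdd_below_smooth_circle)

lemma min_val_ge: "(\<And>q. c \<le> U q) \<Longrightarrow> c \<le> min_val U"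
  unfolding min_val_def by (rule cINF_greatest) auto

text \<open>A lower bound for one function, decreased by \<open>e\<close>, is a lower bound for the
  other; the roles are symmetric.\<close>

lemma min_val_lipschitz:
  assumes "U \<in> smooth_circle" "V \<in> smooth_circle" and "\<And>q. \<bar>V q - U q\<bar> \<le> e"
  shows "\<bar>min_val V - min_val U\<bar> \<le> e"
proof -
  have "min_val U - e \<le> V q" "min_val V - e \<le> U q" for q
    using min_val_le[OF assms(1), of q] min_val_le[OF assms(2), of q] assms(3)[of q] by linarith+
  then have "min_val U - e \<le> min_val V" "min_val V - e \<le> min_val U"
    by (auto intro: min_val_ge)
  then show ?thesis by linarith
qed

lemma funpow_deriv_shift:
  fixes U :: "real \<Rightarrow> real"
  shows "(deriv ^^ k) (\<lambda>q. U q - t) = (if k = 0 then (\<lambda>q. U q - t) else (deriv ^^ k) U)"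
proof -
  \<comment> \<open>An equivalence for every \<open>D\<close> makes the choice in
    \<open>deriv\<close> the same for both functions, so differentiability of \<open>U\<close> need
    not be assumed.\<close>
  have "((\<lambda>q. U q - t) has_field_derivative D) (at x) \<longleftrightarrow> (U has_field_derivative D) (at x)" for D x
    using DERIV_add[of "\<lambda>q. U q - t" D x UNIV "\<lambda>q. t" 0] DERIV_diff[of U D x UNIV "\<lambda>q. t" 0]
    by auto
  then have "deriv (\<lambda>q. U q - t) = deriv U"
    unfolding deriv_def by simp
  then show ?thesis by (cases k) (simp_all add: funpow_Suc_right del: funpow.simps(2))
qed

lemma smooth_circle_shift:
  assumes "U \<in> smooth_circle"
  shows "(\<lambda>q. U q - t) \<in> smooth_circle"
proof -
  have diff: "(deriv ^^ k) U field_differentiable at q" for k q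
    using assms unfolding smooth_circle_def by blast
  have "(deriv ^^ k) (\<lambda>q. U q - t) field_differentiable at q" for k q
    using diff[of k q] by (auto simp: funpow_deriv_shift intro!: derivative_intros)
  then show ?thesis
    using smooth_circle_periodic[OF assms] by (simp add: smooth_circle_def)
qed

lemma simple_Morse_shift: "simple_Morse (\<lambda>q. U q - t) \<longleftrightarrow> simple_Morse U"
  using funpow_deriv_shift[of 1 U t]
  by (simp add: simple_Morse_def local_min_at_def local_max_at_def)

text \<open>Lowering \<open>U2\<close> only widens the gap to \<open>U1\<close>; this fixes the sign
  of the perturbation used later.\<close>

lemma Omega_shift:
  assumes "(U1, U2) \<in> Omega" "t \<ge> 0"
  shows "(U1, \<lambda>q. U2 q - t) \<in> Omega"
proof -
  have "U2 q2 - t < U1 q1" for q1 q2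
    using assms by (auto simp: Omega_def intro: le_less_trans[of _ "U2 q2"])
  then show ?thesis
    using assms by (auto simp: Omega_def smooth_circle_shift simple_Morse_shift)
qed

text \<open>If \<open>U\<close> were constant on the unit interval, every interior point would be a
  local minimum, against uniqueness. This will make \<open>F1\<close> positive at
  \<open>min_val U1\<close>.\<close>

lemma simple_Morse_nonconstant:
  assumes "simple_Morse U"
  shows "\<exists>q\<in>{0..1}. U q \<noteq> c"
proof (rule ccontr)
  assume "\<not> ?thesis"
  then have const: "U q = c" if "q \<in> {0..1}" for q using that by blast
  have "local_min_at U q" if q: "q \<in> {0<..<1}" for q
  proof -
    have "eventually (\<lambda>x. x \<in> {0<..<1}) (at q)"
      using q by (intro eventually_at_in_open') auto
    then show ?thesis unfolding local_min_at_def
      by eventually_elim (use q const in auto)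
  qed
  then have "local_min_at U (1/4)" "local_min_at U (1/2)" by simp_all
  moreover have "(1/4::real) \<in> {0..<1}" "(1/2::real) \<in> {0..<1}" by simp_all
  ultimately have "(1/4::real) = 1/2"
    using assms unfolding simple_Morse_def by blast
  then show False by simp
qed

section \<open>The topology of \<open>Omega\<close>\<close>

lemma mem_Cinf_ball_self: "U \<in> smooth_circle \<Longrightarrow> 0 < e \<Longrightarrow> U \<in> Cinf_ball U k e"
  by (simp add: Cinf_ball_def)

lemma Union_Cinf_balls: "\<Union> {Cinf_ball U k e |U k e. U \<in> smooth_circle \<and> 0 < e} = smooth_circle"
proof
  show "\<Union> {Cinf_ball U k e |U k e. U \<in> smooth_circle \<and> 0 < e} \<subseteq> smooth_circle"
    by (auto simp: Cinf_ball_def)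
  show "smooth_circle \<subseteq> \<Union> {Cinf_ball U k e |U k e. U \<in> smooth_circle \<and> 0 < e}"
  proof
    fix U assume U: "U \<in> smooth_circle"
    then have "U \<in> Cinf_ball U 0 1" by (simp add: mem_Cinf_ball_self)
    with U zero_less_one show "U \<in> \<Union> {Cinf_ball U k e |U k e. U \<in> smooth_circle \<and> 0 < e}"
      by blast
  qed
qed

lemma topspace_Cinf_topology [simp]: "topspace Cinf_topology = smooth_circle"
  by (simp only: Cinf_topology_def topology_generated_by_topspace Union_Cinf_balls)

lemma topspace_Omega_topology [simp]: "topspace Omega_topology = Omega"
  by (auto simp: Omega_topology_def Omega_def)

lemma openin_Cinf_ball:
  "U \<in> smooth_circle \<Longrightarrow> 0 < e \<Longrightarrow> openin Cinf_topology (Cinf_ball U k e)"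
  unfolding Cinf_topology_def by (rule topology_generated_by_Basis) blast

text \<open>A Hoelder estimate of exponent 1/2 in the uniform distance suffices, since balls of
  order 0 are already open. The factor 2 allows for a function and a minimum value each moving by
  \<open>e\<close>.\<close>

lemma continuous_map_Omega_topology_real:
  fixes f :: "(real \<Rightarrow> real) \<times> (real \<Rightarrow> real) \<Rightarrow> real"
  assumes "\<And>U1 U2 V1 V2 e. (U1, U2) \<in> Omega \<Longrightarrow> (V1, V2) \<in> Omega \<Longrightarrow> 0 < e \<Longrightarrow>
    (\<And>q. \<bar>V1 q - U1 q\<bar> \<le> e) \<Longrightarrow> (\<And>q. \<bar>V2 q - U2 q\<bar> \<le> e) \<Longrightarrow>
    \<bar>f (V1, V2) - f (U1, U2)\<bar> \<le> sqrt (2 * e)"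
  shows "continuous_map Omega_topology euclideanreal f"
proof -
  have "\<exists>W. openin Omega_topology W \<and> x \<in> W \<and> (\<forall>y\<in>W. f y \<in> ball (f x) \<epsilon>)"
    if x: "x \<in> Omega" and \<epsilon>: "\<epsilon> > 0" for x \<epsilon>
  proof -
    obtain U1 U2 where xU: "x = (U1, U2)" by (cases x)
    have U: "U1 \<in> smooth_circle" "U2 \<in> smooth_circle"
      using x by (auto simp: xU Omega_def)
    \<comment> \<open>Chosen so that \<open>sqrt (2 * e)\<close> equals
      \<open>\<epsilon> / 2\<close>.\<close>
    define e where "e = \<epsilon>\<^sup>2 / 8"
    have e: "e > 0" using \<epsilon> by (simp add: e_def)
    have "2 * e = (\<epsilon> / 2)\<^sup>2" by (simp add: e_def power2_eq_square)
    then have e\<epsilon>: "sqrt (2 * e) < \<epsilon>"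
      using \<epsilon> by (metis abs_of_pos half_gt_zero real_sqrt_abs field_sum_of_halves less_add_same_cancel1)
    define W where "W = (Cinf_ball U1 0 e \<times> Cinf_ball U2 0 e) \<inter> Omega"
    have "openin Omega_topology W"
      unfolding W_def Omega_topology_def
      by (intro openin_subtopology_Int openin_prod_Times_iff[THEN iffD2] disjI2 conjI
          openin_Cinf_ball U e)
    moreover have "x \<in> W"
      using x U e by (simp add: W_def xU mem_Cinf_ball_self)
    moreover have "f y \<in> ball (f x) \<epsilon>" if "y \<in> W" for y
    proof -
      obtain V1 V2 where yV: "y = (V1, V2)" by (cases y)
      have "\<bar>f (V1, V2) - f (U1, U2)\<bar> \<le> sqrt (2 * e)"
        using that x e by (intro assms) (auto simp: W_def xU yV Cinf_ball_def intro: less_imp_le)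
      then show ?thesis
        using e\<epsilon> by (simp add: xU yV dist_real_def abs_minus_commute)
    qed
    ultimately show ?thesis by blast
  qed
  then have "continuous_map Omega_topology Met_TC.mtopology f"
    unfolding Met_TC.continuous_map_to_metric by simp
  then show ?thesis by simp
qed

lemma continuous_map_shift:
  assumes U: "U \<in> smooth_circle"
  shows "continuous_map euclideanreal Cinf_topology (\<lambda>t q. U q - t)"
  unfolding Cinf_topology_def
proof (rule continuous_on_generated_topo)
  let ?f = "\<lambda>t q. U q - t"
  show "?f ` topspace euclideanreal \<subseteq> \<Union> {Cinf_ball U k e |U k e. U \<in> smooth_circle \<and> 0 < e}"
    unfolding Union_Cinf_balls using smooth_circle_shift[OF U] by blast
next
  let ?f = "\<lambda>t q. U q - t"
  fix B assume "B \<in> {Cinf_ball U k e |U k e. U \<in> smooth_circle \<and> 0 < e}"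
  then obtain V k e where B: "B = Cinf_ball V k e" and V: "V \<in> smooth_circle" and e: "0 < e"
    by blast
  have "open (?f -` B)"
  proof (cases "k = 0")
    case False
    \<comment> \<open>Derivatives of positive order do not depend on \<open>t\<close>, so either
      every shift lies in the ball or none does.\<close>
    then have "?f -` B = UNIV \<or> ?f -` B = {}"
      by (auto simp: B Cinf_ball_def funpow_deriv_shift smooth_circle_shift[OF U])
    then show ?thesis by auto
  next
    case True
    define g where "g = (\<lambda>q. U q - V q)"
    have per: "g (q + 1) = g q" for q
      by (simp add: g_def smooth_circle_periodic U V)
    have cont: "continuous_on UNIV g"
      unfolding g_def by (intro continuous_intros smooth_circle_continuous U V)
    obtain p where p: "\<And>q. g q \<le> g p"
      using periodic_continuous_attains_sup[OF per cont] by blast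
    obtain r where r: "\<And>q. g r \<le> g q"
      using periodic_continuous_attains_inf[OF per cont] by blast
    have "?f -` B = {t. \<forall>q. \<bar>g q - t\<bar> < e}"
      using True by (auto simp: B Cinf_ball_def smooth_circle_shift[OF U] g_def algebra_simps)
    \<comment> \<open>Because \<open>g\<close> attains its extrema, at \<open>p\<close> and
      \<open>r\<close>, the infinitely many strict conditions reduce to two and define an open
      interval.\<close>
    also have "\<dots> = {g p - e <..< g r + e}"
    proof (intro equalityI subsetI)
      fix t assume "t \<in> {t. \<forall>q. \<bar>g q - t\<bar> < e}"
      then have "\<bar>g p - t\<bar> < e" "\<bar>g r - t\<bar> < e" by blast+
      then show "t \<in> {g p - e <..< g r + e}" by auto
    next
      fix t assume t: "t \<in> {g p - e <..< g r + e}"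
      have "\<bar>g q - t\<bar> < e" for q using t p[of q] r[of q] by auto
      then show "t \<in> {t. \<forall>q. \<bar>g q - t\<bar> < e}" by blast
    qed
    finally show ?thesis by simp
  qed
  then show "openin euclideanreal (?f -` B \<inter> topspace euclideanreal)" by simp
qed

text \<open>The parameter is restricted to the half-line on which \<open>Omega_shift\<close> keeps
  the path inside \<open>Omega\<close>.\<close>

lemma continuous_map_Omega_shift:
  assumes U: "(U1, U2) \<in> Omega"
  shows "continuous_map (top_of_set {0..}) Omega_topology (\<lambda>t. (U1, \<lambda>q. U2 q - t))"
  unfolding Omega_topology_def
proof (rule continuous_map_into_subtopology)
  have U': "U1 \<in> smooth_circle" "U2 \<in> smooth_circle" using U by (auto simp: Omega_def)
  show "continuous_map (top_of_set {0..}) (prod_topology Cinf_topology Cinf_topology)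
    (\<lambda>t. (U1, \<lambda>q. U2 q - t))"
    using U' by (auto simp: continuous_map_pairwise o_def
        intro: continuous_map_from_subtopology continuous_map_shift)
  show "(\<lambda>t. (U1, \<lambda>q. U2 q - t)) \<in> topspace (top_of_set {0..}) \<rightarrow> Omega"
    using Omega_shift[OF U] by auto
qed

section \<open>The quotient at the minimum of the first potential\<close>

lemma F1_min_val:
  assumes "U \<in> smooth_circle"
  shows "F1 U (min_val U) = integral {0..1} (\<lambda>q. sqrt (U q - min_val U))"
proof -
  have "{q \<in> {0..1}. U q \<ge> min_val U} = {0..1}" using min_val_le[OF assms] by auto
  then show ?thesis by (simp add: F1_def)
qed

lemma Omega_le_min_val: "(U1, U2) \<in> Omega \<Longrightarrow> U2 q \<le> min_val U1"
  by (intro min_val_ge) (auto simp: Omega_def less_imp_le)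

lemma F2_min_val:
  assumes "(U1, U2) \<in> Omega"
  shows "F2 U2 (min_val U1) = integral {0..1} (\<lambda>q. sqrt (min_val U1 - U2 q))"
proof -
  have "{q \<in> {0..1}. U2 q \<le> min_val U1} = {0..1}" using Omega_le_min_val[OF assms] by auto
  then show ?thesis by (simp add: F2_def)
qed

text \<open>Subadditivity of the square root. A Lipschitz bound is impossible near 0, a value that
  \<open>U1 q - min_val U1\<close> does attain.\<close>

lemma abs_diff_sqrt_le:
  assumes "0 \<le> a" "0 \<le> b"
  shows "\<bar>sqrt a - sqrt b\<bar> \<le> sqrt \<bar>a - b\<bar>"
proof -
  have *: "\<bar>sqrt a - sqrt b\<bar> \<le> sqrt \<bar>a - b\<bar>" if "0 \<le> a" "a \<le> b" for a b
    using that sqrt_add_le_add_sqrt[of a "b - a"] by simp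
  show ?thesis
    using *[of a b] *[of b a] assms by (cases "a \<le> b") (auto simp: abs_minus_commute)
qed

text \<open>The interval has length 1, so the pointwise bound \<open>sqrt e\<close> carries over to
  the integrals unchanged.\<close>

lemma integral_sqrt_diff_le:
  fixes f g :: "real \<Rightarrow> real"
  assumes "continuous_on {0..1} f" "continuous_on {0..1} g"
    and "\<And>q. 0 \<le> f q" "\<And>q. 0 \<le> g q" "\<And>q. \<bar>f q - g q\<bar> \<le> e"
  shows "\<bar>integral {0..1} (\<lambda>q. sqrt (f q)) - integral {0..1} (\<lambda>q. sqrt (g q))\<bar> \<le> sqrt e"
proof -
  have int: "(\<lambda>q. sqrt (f q)) integrable_on {0..1}" "(\<lambda>q. sqrt (g q)) integrable_on {0..1}"
    by (intro integrable_continuous_interval continuous_intros assms)+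
  have "\<bar>sqrt (f q) - sqrt (g q)\<bar> \<le> sqrt e" for q
    using abs_diff_sqrt_le[OF assms(3,4), of q q] assms(5)[of q]
    by (meson order_trans real_sqrt_le_mono)
  then have "norm (integral {0..1} (\<lambda>q. sqrt (f q) - sqrt (g q))) \<le> integral {0..1} (\<lambda>q::real. sqrt e)"
    using int by (intro integral_norm_bound_integral integrable_diff) auto
  then show ?thesis
    using int by (simp add: integral_diff)
qed

lemma continuous_map_F1_min_val:
  "continuous_map Omega_topology euclideanreal (\<lambda>(U1, U2). F1 U1 (min_val U1))"
proof (rule continuous_map_Omega_topology_real)
  fix U1 U2 V1 V2 e
  assume "(U1, U2) \<in> Omega" "(V1, V2) \<in> Omega" and 1: "\<And>q. \<bar>V1 q - U1 q\<bar> \<le> (e::real)"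
  then have sm: "U1 \<in> smooth_circle" "V1 \<in> smooth_circle" by (auto simp: Omega_def)
  have "\<bar>(V1 q - min_val V1) - (U1 q - min_val U1)\<bar> \<le> 2 * e" for q
    using 1[of q] min_val_lipschitz[OF sm 1] by linarith
  then have "\<bar>F1 V1 (min_val V1) - F1 U1 (min_val U1)\<bar> \<le> sqrt (2 * e)"
    unfolding F1_min_val[OF sm(1)] F1_min_val[OF sm(2)]
    by (intro integral_sqrt_diff_le continuous_intros smooth_circle_continuous sm)
      (auto simp: min_val_le sm)
  then show "\<bar>(case (V1, V2) of (U1, U2) \<Rightarrow> F1 U1 (min_val U1)) -
      (case (U1, U2) of (U1, U2) \<Rightarrow> F1 U1 (min_val U1))\<bar> \<le> sqrt (2 * e)" by simp
qed

lemma continuous_map_F2_min_val: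
  "continuous_map Omega_topology euclideanreal (\<lambda>(U1, U2). F2 U2 (min_val U1))"
proof (rule continuous_map_Omega_topology_real)
  fix U1 U2 V1 V2 e
  assume U: "(U1, U2) \<in> Omega" and V: "(V1, V2) \<in> Omega"
    and 1: "\<And>q. \<bar>V1 q - U1 q\<bar> \<le> (e::real)" and 2: "\<And>q. \<bar>V2 q - U2 q\<bar> \<le> e"
  have sm: "U1 \<in> smooth_circle" "V1 \<in> smooth_circle" "U2 \<in> smooth_circle" "V2 \<in> smooth_circle"
    using U V by (auto simp: Omega_def)
  have "\<bar>(min_val V1 - V2 q) - (min_val U1 - U2 q)\<bar> \<le> 2 * e" for q
    using 2[of q] min_val_lipschitz[OF sm(1,2) 1] by linarith
  then have "\<bar>F2 V2 (min_val V1) - F2 U2 (min_val U1)\<bar> \<le> sqrt (2 * e)"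
    unfolding F2_min_val[OF U] F2_min_val[OF V]
    by (intro integral_sqrt_diff_le continuous_intros smooth_circle_continuous sm)
      (auto simp: Omega_le_min_val[OF U] Omega_le_min_val[OF V])
  then show "\<bar>(case (V1, V2) of (U1, U2) \<Rightarrow> F2 U2 (min_val U1)) -
      (case (U1, U2) of (U1, U2) \<Rightarrow> F2 U2 (min_val U1))\<bar> \<le> sqrt (2 * e)" by simp
qed

text \<open>A continuous nonnegative integrand with integral 0 would vanish identically and force
  \<open>U1\<close> to be constant on the unit interval.\<close>

lemma F1_min_val_pos:
  assumes "(U1, U2) \<in> Omega"
  shows "F1 U1 (min_val U1) > 0"
proof -
  have sm: "U1 \<in> smooth_circle" and M: "simple_Morse U1" using assms by (auto simp: Omega_def)
  have cont: "continuous_on {0..1} (\<lambda>q. sqrt (U1 q - min_val U1))"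
    by (intro continuous_intros smooth_circle_continuous sm)
  have "F1 U1 (min_val U1) \<noteq> 0"
    unfolding F1_min_val[OF sm]
    using integral_eq_0_iff[OF cont] min_val_le[OF sm] simple_Morse_nonconstant[OF M, of "min_val U1"]
    by auto
  moreover have "F1 U1 (min_val U1) \<ge> 0"
    unfolding F1_min_val[OF sm]
    by (intro integral_nonneg integrable_continuous_interval cont) (auto simp: min_val_le[OF sm])
  ultimately show ?thesis by simp
qed

text \<open>Numerator and denominator are separate case expressions so that they match literally the
  two maps whose continuity was just proved.\<close>

definition min_quotient :: "(real \<Rightarrow> real) \<times> (real \<Rightarrow> real) \<Rightarrow> real" where
  "min_quotient x = (case x of (U1, U2) \<Rightarrow> F2 U2 (min_val U1)) /
     (case x of (U1, U2) \<Rightarrow> F1 U1 (min_val U1))"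

lemma continuous_map_min_quotient: "continuous_map Omega_topology euclideanreal min_quotient"
  unfolding min_quotient_def
  by (intro continuous_map_real_divide continuous_map_F1_min_val continuous_map_F2_min_val)
    (auto dest: F1_min_val_pos)

text \<open>The shift leaves the positive denominator alone and raises the integrand of the
  numerator at every point.\<close>

lemma min_quotient_shift_less:
  assumes U: "(U1, U2) \<in> Omega" and "t > 0"
  shows "min_quotient (U1, U2) < min_quotient (U1, \<lambda>q. U2 q - t)"
proof -
  have sm: "U2 \<in> smooth_circle" using U by (auto simp: Omega_def)
  have "F2 U2 (min_val U1) < F2 (\<lambda>q. U2 q - t) (min_val U1)"
    unfolding F2_min_val[OF U] F2_min_val[OF Omega_shift[OF U less_imp_le[OF \<open>t > 0\<close>]]]
    using \<open>t > 0\<close>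
    by (intro integral_less_real continuous_intros smooth_circle_continuous sm) auto
  then show ?thesis
    using F1_min_val_pos[OF U] by (simp add: min_quotient_def divide_strict_right_mono)
qed

lemma rational_min_quotient_in_openin:
  assumes W: "openin Omega_topology W" and x: "x \<in> W"
  shows "\<exists>y\<in>W. min_quotient y \<in> \<rat>"
proof -
  obtain U1 U2 where xU: "x = (U1, U2)" by (cases x)
  have U: "(U1, U2) \<in> Omega"
    using openin_subset[OF W] x by (auto simp: xU)
  define path where "path = (\<lambda>t. (U1, \<lambda>q. U2 q - t))"
  have path: "continuous_map (top_of_set {0..}) Omega_topology path"
    unfolding path_def by (rule continuous_map_Omega_shift[OF U])
  have path0: "path 0 = x" by (simp add: path_def xU)
  \<comment> \<open>Relative openness at 0 provides an initial stretch of the path, of length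
    \<open>d\<close>, inside \<open>W\<close>.\<close>
  have "openin (top_of_set {0..}) {t \<in> {0..}. path t \<in> W}"
    using openin_continuous_map_preimage[OF path W] by simp
  moreover have "0 \<in> {t \<in> {0..}. path t \<in> W}"
    using x path0 by simp
  ultimately obtain d where d: "d > 0"
    and "\<forall>t\<in>{0..}. dist t 0 < d \<longrightarrow> t \<in> {t \<in> {0..}. path t \<in> W}"
    unfolding openin_euclidean_subtopology_iff by meson
  then have in_W: "path t \<in> W" if "t \<ge> 0" "dist t 0 < d" for t
    using that by simp
  \<comment> \<open>The endpoint \<open>d / 2\<close> keeps the closed segment strictly within
    distance \<open>d\<close>; a rational between the two end values is then attained by the
    intermediate value theorem.\<close>
  have "min_quotient (path 0) < min_quotient (path (d / 2))"
    using min_quotient_shift_less[OF U, of "d / 2"] d by (simp add: path_def)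
  then obtain r where r: "r \<in> \<rat>" "min_quotient (path 0) < r" "r < min_quotient (path (d / 2))"
    using Rats_dense_in_real by blast
  have "continuous_on {0..} (min_quotient \<circ> path)"
    using continuous_map_compose[OF path continuous_map_min_quotient] by simp
  then have "continuous_on {0..d / 2} (min_quotient \<circ> path)"
    by (rule continuous_on_subset) auto
  then obtain t where t: "0 \<le> t" "t \<le> d / 2" "min_quotient (path t) = r"
    using IVT'[of "min_quotient \<circ> path" 0 r "d / 2"] r d by auto
  moreover have "path t \<in> W"
    using t d by (intro in_W) (auto simp: dist_real_def)
  ultimately show ?thesis
    using r(1) by blast
qed

text \<open>The level set is closed and so contains the closure of \<open>A\<close>, while every
  nonempty open set has a pair with rational quotient. Arbitrary subsets are allowed because
  \<open>first_category_in\<close> asks for an exact union, for which the levels must be cut down to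
  the given set.\<close>

lemma nowhere_dense_min_quotient_level:
  assumes "A \<subseteq> {x \<in> Omega. min_quotient x \<in> diophantine_level n}"
  shows "nowhere_dense_in Omega_topology A"
proof -
  let ?C = "{x \<in> Omega. min_quotient x \<in> diophantine_level n}"
  have "closedin Omega_topology ?C"
    using closedin_continuous_map_preimage[OF continuous_map_min_quotient,
        of "diophantine_level n"] closed_diophantine_level by simp
  then have cl: "Omega_topology closure_of A \<subseteq> ?C"
    using assms by (simp add: closure_of_minimal)
  have False if W: "openin Omega_topology W" "x \<in> W" "W \<subseteq> Omega_topology closure_of A" for W x
    using rational_min_quotient_in_openin[OF W(1,2)] rational_notin_diophantine_level W(3) cl
    by blast
  then have "Omega_topology interior_of (Omega_topology closure_of A) = {}"
    by (auto simp: interior_of_def)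
  then show ?thesis
    using assms by (auto simp: nowhere_dense_in_def)
qed

theorem mainTheorem3:
  shows "first_category_in Omega_topology {(U1, U2) \<in> Omega. nondegenerate_metric U1 U2}"
proof -
  let ?S = "{(U1, U2) \<in> Omega. nondegenerate_metric U1 U2}"
  define A where "A n = {x \<in> ?S. min_quotient x \<in> diophantine_level n}" for n
  have "\<exists>n. x \<in> A n" if "x \<in> ?S" for x
  proof -
    obtain U1 U2 where xU: "x = (U1, U2)" by (cases x)
    \<comment> \<open>This is the case \<open>c2\<close> of the last condition of
      nondegeneracy.\<close>
    have "typical (F2 U2 (min_val U1) / F1 U1 (min_val U1))"
      using that by (simp add: xU nondegenerate_metric_def Let_def)
    then have "typical (min_quotient x)"
      by (simp add: xU min_quotient_def)
    then show ?thesis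
      using typical_imp_diophantine_level that by (auto simp: A_def)
  qed
  then have "?S = (\<Union>n. A n)"
    by (auto simp: A_def)
  moreover have "nowhere_dense_in Omega_topology (A n)" for n
    by (rule nowhere_dense_min_quotient_level[of _ n]) (auto simp: A_def)
  ultimately show ?thesis unfolding first_category_in_def by blast
qed

end
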